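(* Let $\rho>0$, $c>0$, and let $\{u^\nu=(w^\nu,x^\nu,\eta^\nu,\zeta^\nu)\}_{\nu\ge 0}$ in $W\times X\times S$ be the infinite sequence generated by the augmented decomposition algorithm (ADA). Then $$\|u^\nu-u^{\nu+1}\|_G^2=o(1/\nu)$$ holds, and thus $$\|x^\nu-x^{\nu+1}\|_2^2=o(1/\nu)\qquad\text{and}\qquad \Big\|\sum_{k=1}^K E_kx_k^{\nu+1}\Big\|_2^2=o(1/\nu)$$ as $\nu\to\infty$.
   Context: Problem. Consider the problem (P): minimize $f(x)=f_1(x_1)+\cdots+f_K(x_K)$ subject to $Ex=E_1x_1+\cdots+E_Kx_K=q$, $x_k\in X_k$ ($k=1,\dots,K$), where $x=(x_1,\dots,x_K)\in\mathbb{R}^{n_1}\times\cdots\times\mathbb{R}^{n_K}=\mathbb{R}^n$, each $f_k$ is a closed proper convex function on $\mathbb{R}^{n_k}$ (possibly nonsmooth), each $X_k\subset\mathbb{R}^{n_k}$ is a closed convex set, $X=X_1\times\cdots\times X_K$, $E=(E_1,\dots,E_K)\in\mathbb{R}^{m\times n}$, $q\in\mathbb{R}^m$. In this statement $q=0$. Standing assumption. The global minimum of (P) is attained, and $\mathrm{int}(X)\cap\mathrm{dom} f\cap\{x: Ex=q\}\neq\emptyset$ (or, alternatively, if $X$ is polyhedral, $X\cap\mathrm{int}(\mathrm{dom} f)\cap\{x:Ex=q\}\ne\emptyset$); moreover the Lagrangian $L(x,y)=f(x)+\langle Ex-q,y\rangle$ has a saddle point, i.e. there are $\bar x\in X$,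 $\bar y\in\mathbb{R}^m$ with $\bar x\in\arg\min_{x\in X}L(x,\bar y)$ and $\bar y\in\arg\max_{y\in\mathbb{R}^m}L(\bar x,y)$. Spaces. $W=\{w=(w_1,\dots,w_K)\in(\mathbb{R}^m)^K: w_1+\cdots+w_K=0\}$, $W^\perp=\{w\in(\mathbb{R}^m)^K: w_1=\cdots=w_K\}$, $P_{W^\perp}$ is the orthogonal projection onto $W^\perp$ (each component replaced by the average of the components), and $S=\{(\eta,\zeta)\in(\mathbb{R}^m)^K\times W^\perp: P_{W^\perp}(\eta)=\zeta\}$. ADA (with $q=0$). Given $w^0\in W$, $x^0\in X$, $(\eta^0,\zeta^0)\in S$, put $y^0=\frac12(\eta^0+\zeta^0)\in(\mathbb{R}^m)^K$. For $\nu=0,1,2,\dots$ and $k=1,\dots,K$: $x_k^{\nu+1}=\arg\min_{x_k\in X_k}\{f_k(x_k)+\frac{\rho}{4}\|E_kx_k-w_k^\nu+\frac{2}{\rho}y_k^\nu\|_2^2+\frac{1}{2c}\|x_k-x_k^\nu\|_2^2\}$; $\eta_k^{\nu+1}=y_k^\nu+\frac{\rho}{2}[E_kx_k^{\nu+1}-w_k^\nu]$; $\zeta_k^{\nu+1}=\frac1K\sum_{j=1}^K\eta_j^{\nu+1}$; $w_k^{\nu+1}=w_k^\nu+\frac1\rho[\eta_k^{\nu+1}-\zeta_k^{\nu+1}]$; $y_k^{\nu+1}=\frac12[\eta_k^{\nu+1}+\zeta_k^{\nu+1}]$. Norm. $\|(w,x,\eta,\zeta)\|_G^2=\rho\|w\|^2+\frac1c\|x\|^2+\frac1\rho\|\eta\|^2+\frac1\rho\|\zeta\|^2$.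 *)

theory Defs
  imports "HOL-Analysis.Analysis" "HOL-Library.Landau_Symbols"
begin

text \<open>
  Block structure.  The product of the spaces R^{n_k} has as its coordinates the index type
  \<open>'n\<close>; the map \<open>b :: 'n \<Rightarrow> 'k\<close> tells to which block a coordinate belongs, so n_k is the
  number of \<open>i\<close> with \<open>b i = k\<close>, and K is \<open>CARD('k)\<close>.  The factor R^{n_k} is represented by
  the vectors that vanish outside block \<open>k\<close>.  For such a vector \<open>z\<close> the product \<open>E_k z\<close> with
  the k-th column block of \<open>E\<close> is simply \<open>E *v z\<close>, and its norm is the Euclidean norm
  in R^{n_k}.
\<close>

definition block_space :: "('n::finite \<Rightarrow> 'k::finite) \<Rightarrow> 'k \<Rightarrow> (real ^ 'n) set" where
  "block_space b k = {z. \<forall>i. b i \<noteq> k \<longrightarrow> z $ i = 0}"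

definition block :: "('n::finite \<Rightarrow> 'k::finite) \<Rightarrow> 'k \<Rightarrow> real ^ 'n \<Rightarrow> real ^ 'n" where
  "block b k x = (\<chi> i. if b i = k then x $ i else 0)"

definition block_product ::
    "('n::finite \<Rightarrow> 'k::finite) \<Rightarrow> ('k \<Rightarrow> (real ^ 'n) set) \<Rightarrow> (real ^ 'n) set" where
  "block_product b X = {x. \<forall>k. block b k x \<in> X k}"

text \<open>
  A function on the subspace \<open>V\<close> is given by a total function of which only the values on
  \<open>V\<close> matter.  "Closed" means that the epigraph is closed.
\<close>

definition ereal_epigraph ::
    "'a::euclidean_space set \<Rightarrow> ('a \<Rightarrow> ereal) \<Rightarrow> ('a \<times> real) set" where
  "ereal_epigraph V f = {(z, t). z \<in> V \<and> f z \<le> ereal t}"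

definition closed_proper_convex_on ::
    "'a::euclidean_space set \<Rightarrow> ('a \<Rightarrow> ereal) \<Rightarrow> bool" where
  "closed_proper_convex_on V f \<longleftrightarrow>
     closed (ereal_epigraph V f) \<and> convex (ereal_epigraph V f) \<and>
     (\<forall>z\<in>V. f z \<noteq> -\<infinity>) \<and> (\<exists>z\<in>V. f z \<noteq> \<infinity>)"

definition effective_domain :: "('a \<Rightarrow> ereal) \<Rightarrow> 'a set" where
  "effective_domain f = {x. f x < \<infinity>}"

definition objective ::
    "('n::finite \<Rightarrow> 'k::finite) \<Rightarrow> ('k \<Rightarrow> real ^ 'n \<Rightarrow> ereal) \<Rightarrow> real ^ 'n \<Rightarrow> ereal" where
  "objective b f x = (\<Sum>k\<in>UNIV. f k (block b k x))"

definition lagrangian ::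
    "('n::finite \<Rightarrow> 'k::finite) \<Rightarrow> ('k \<Rightarrow> real ^ 'n \<Rightarrow> ereal) \<Rightarrow>
     real ^ 'n ^ 'm::finite \<Rightarrow> real ^ 'm \<Rightarrow> real ^ 'n \<Rightarrow> real ^ 'm \<Rightarrow> ereal" where
  "lagrangian b f E q x y = objective b f x + ereal ((E *v x - q) \<bullet> y)"

definition problem_data ::
    "('n::finite \<Rightarrow> 'k::finite) \<Rightarrow> ('k \<Rightarrow> real ^ 'n \<Rightarrow> ereal) \<Rightarrow> ('k \<Rightarrow> (real ^ 'n) set) \<Rightarrow> bool" where
  "problem_data b f X \<longleftrightarrow>
     (\<forall>k. closed_proper_convex_on (block_space b k) (f k) \<and>
          X k \<subseteq> block_space b k \<and> closed (X k) \<and> convex (X k))"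

definition standing_assumption ::
    "('n::finite \<Rightarrow> 'k::finite) \<Rightarrow> ('k \<Rightarrow> real ^ 'n \<Rightarrow> ereal) \<Rightarrow> ('k \<Rightarrow> (real ^ 'n) set) \<Rightarrow>
     real ^ 'n ^ 'm::finite \<Rightarrow> real ^ 'm \<Rightarrow> bool" where
  "standing_assumption b f X E q \<longleftrightarrow>
     (\<exists>x. is_arg_min (objective b f) (\<lambda>x. x \<in> block_product b X \<and> E *v x = q) x) \<and>
     (interior (block_product b X) \<inter> effective_domain (objective b f) \<inter> {x. E *v x = q} \<noteq> {} \<or>
      polyhedron (block_product b X) \<and>
      block_product b X \<inter> interior (effective_domain (objective b f)) \<inter> {x. E *v x = q} \<noteq> {}) \<and>
     (\<exists>xb yb.
        is_arg_min (\<lambda>x. lagrangian b f E q x yb) (\<lambda>x. x \<in> block_product b X) xb \<and>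
        is_arg_max (\<lambda>y. lagrangian b f E q xb y) (\<lambda>y. True) yb)"

definition W_space :: "(real ^ 'm::finite ^ 'k::finite) set" where
  "W_space = {w. (\<Sum>k\<in>UNIV. w $ k) = 0}"

definition W_perp :: "(real ^ 'm::finite ^ 'k::finite) set" where
  "W_perp = {w. \<forall>j k. w $ j = w $ k}"

text \<open>
  The orthogonal projection onto a subspace is the metric projection \<^const>\<open>closest_point\<close>.
\<close>

definition S_set :: "((real ^ 'm::finite ^ 'k::finite) \<times> (real ^ 'm ^ 'k)) set" where
  "S_set = {(\<eta>, \<zeta>). \<zeta> \<in> W_perp \<and> closest_point W_perp \<eta> = \<zeta>}"

lemma closest_point_W_perp:
  fixes v :: "real ^ 'm::finite ^ 'k::finite"
  shows "closest_point W_perp v = (\<chi> k. (1 / real CARD('k)) *\<^sub>R (\<Sum>j\<in>UNIV. v $ j))"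
    (is "_ = ?a")
proof -
  have sub: "subspace (W_perp :: (real ^ 'm ^ 'k) set)"
    unfolding subspace_def W_perp_def mem_Collect_eq zero_index vector_add_component
      vector_scaleR_component
    by (intro conjI ballI allI refl arg_cong2[where f = "(+)"] arg_cong2[where f = scaleR]) blast+
  have a: "?a \<in> W_perp" by (simp add: W_perp_def)
  have "dist v ?a \<le> dist v z" if z: "z \<in> W_perp" for z
  proof -
    define d where "d = ?a - z"
    define e where "e = d $ undefined"
    have "\<forall>j k. z $ j = z $ k" using z by (simp add: W_perp_def)
    hence "z $ k = z $ undefined" for k by blast
    hence e: "d $ k = e" for k by (simp add: d_def e_def)
    have s: "(\<Sum>k\<in>UNIV. (v - ?a) $ k) = 0"
      by (simp add: sum_subtractf sum_constant_scaleR del: sum_constant)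
    have "(v - ?a) \<bullet> d = (\<Sum>k\<in>UNIV. (v - ?a) $ k \<bullet> e)"
      unfolding inner_vec_def[of "v - ?a"] e ..
    also have "\<dots> = 0"
      unfolding inner_sum_left[symmetric] s by (rule inner_zero_left)
    finally have "orthogonal (v - ?a) d" by (simp only: orthogonal_def)
    hence "(norm ((v - ?a) + d))\<^sup>2 = (norm (v - ?a))\<^sup>2 + (norm d)\<^sup>2"
      by (rule norm_add_Pythagorean)
    moreover have "(v - ?a) + d = v - z" unfolding d_def by (simp only: algebra_simps)
    ultimately have "(norm (v - ?a))\<^sup>2 \<le> (norm (v - z))\<^sup>2" by simp
    thus ?thesis unfolding dist_norm by (rule power2_le_imp_le) (rule norm_ge_zero)
  qed
  hence "\<forall>z\<in>W_perp. dist v ?a \<le> dist v z" by blast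
  thus ?thesis
    by (rule closest_point_unique[OF subspace_imp_convex[OF sub] closed_subspace[OF sub] a, symmetric])
qed

text \<open>
  The ADA iteration for q = 0.  Members of (R^m)^K are vectors of type \<open>real ^ 'm ^ 'k\<close>.
\<close>

definition ada ::
    "('n::finite \<Rightarrow> 'k::finite) \<Rightarrow> ('k \<Rightarrow> real ^ 'n \<Rightarrow> ereal) \<Rightarrow> ('k \<Rightarrow> (real ^ 'n) set) \<Rightarrow>
     real ^ 'n ^ 'm::finite \<Rightarrow> real \<Rightarrow> real \<Rightarrow>
     (nat \<Rightarrow> real ^ 'm ^ 'k) \<Rightarrow> (nat \<Rightarrow> real ^ 'n) \<Rightarrow> (nat \<Rightarrow> real ^ 'm ^ 'k) \<Rightarrow>
     (nat \<Rightarrow> real ^ 'm ^ 'k) \<Rightarrow> (nat \<Rightarrow> real ^ 'm ^ 'k) \<Rightarrow> bool" where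
  "ada b f X E \<rho> c w x \<eta> \<zeta> y \<longleftrightarrow>
     w 0 \<in> W_space \<and> x 0 \<in> block_product b X \<and> (\<eta> 0, \<zeta> 0) \<in> S_set \<and>
     y 0 = (1/2) *\<^sub>R (\<eta> 0 + \<zeta> 0) \<and>
     (\<forall>\<nu> k.
        is_arg_min
          (\<lambda>z. f k z + ereal (\<rho> / 4 * (norm (E *v z - w \<nu> $ k + (2 / \<rho>) *\<^sub>R y \<nu> $ k))\<^sup>2
                              + 1 / (2 * c) * (norm (z - block b k (x \<nu>)))\<^sup>2))
          (\<lambda>z. z \<in> X k)
          (block b k (x (Suc \<nu>))) \<and>
        \<eta> (Suc \<nu>) $ k = y \<nu> $ k + (\<rho> / 2) *\<^sub>R (E *v block b k (x (Suc \<nu>)) - w \<nu> $ k) \<and>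
        \<zeta> (Suc \<nu>) $ k = (1 / real CARD('k)) *\<^sub>R (\<Sum>j\<in>UNIV. \<eta> (Suc \<nu>) $ j) \<and>
        w (Suc \<nu>) $ k = w \<nu> $ k + (1 / \<rho>) *\<^sub>R (\<eta> (Suc \<nu>) $ k - \<zeta> (Suc \<nu>) $ k) \<and>
        y (Suc \<nu>) $ k = (1/2) *\<^sub>R (\<eta> (Suc \<nu>) $ k + \<zeta> (Suc \<nu>) $ k))"

fun G_norm_sq ::
    "real \<Rightarrow> real \<Rightarrow>
     (real ^ 'm::finite ^ 'k::finite) \<times> (real ^ 'n::finite) \<times> (real ^ 'm ^ 'k) \<times> (real ^ 'm ^ 'k) \<Rightarrow> real" where
  "G_norm_sq \<rho> c (w, x, \<eta>, \<zeta>) =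
     \<rho> * (norm w)\<^sup>2 + 1 / c * (norm x)\<^sup>2 + 1 / \<rho> * (norm \<eta>)\<^sup>2 + 1 / \<rho> * (norm \<zeta>)\<^sup>2"

end

theory Submission
  imports Defs
begin

text \<open>
  With \<open>\<omega> = \<eta> - \<zeta> \<in> W\<close>, ADA is the proximal point algorithm for the monotone operator
  \<open>T (w, x, \<omega>, \<zeta>) = (- \<omega>, \<partial>(f + \<delta>\<^sub>X) x + E\<^sup>T (\<omega> + \<zeta>), w - P\<^sub>W E x, - P\<^sub>W\<^sub>\<bottom> E x)\<close>, the sum of a
  subdifferential and a skew map, in the metric \<open>G\<close>: since \<open>\<omega>\<close> and \<open>\<zeta>\<close> are orthogonal,
  \<open>\<parallel>\<eta>\<parallel>\<^sup>2 + \<parallel>\<zeta>\<parallel>\<^sup>2 = \<parallel>\<omega>\<parallel>\<^sup>2 + 2 \<parallel>\<zeta>\<parallel>\<^sup>2\<close>.  A saddle point gives a zero of \<open>T\<close>, hence the squared step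
  lengths are summable; monotonicity of \<open>T\<close> makes them decreasing, and so they are \<open>o(1/\<nu>)\<close>.
\<close>

section \<open>Rate of summable decreasing sequences\<close>

text \<open>More than \<open>n / 2\<close> indices lie between \<open>n div 2\<close> and
  \<open>n\<close>, and each term there is at least \<open>a n\<close>. So
  \<open>n / 2 * a n\<close> is bounded by a section of the series, which the Cauchy criterion makes
  small.\<close>

lemma summable_decseq_smallo:
  fixes a :: "nat \<Rightarrow> real"
  assumes nonneg: "\<And>n. 0 \<le> a n" and dec: "decseq a" and sum: "summable a"
  shows "a \<in> o(\<lambda>n. 1 / real n)"
proof (rule landau_o.smallI)
  fix e :: real assume "e > 0"
  hence "e / 2 > 0" by simp
  then obtain N where N: "\<And>m n. m \<ge> N \<Longrightarrow> norm (sum a {m..<n}) < e / 2"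
    using sum unfolding summable_Cauchy by meson
  \<comment> \<open>The threshold gives \<open>n div 2 \<ge> N\<close> and keeps \<open>n\<close>
    positive, so that \<open>1 / real n\<close> is not the default value
    \<open>1 / 0 = 0\<close>.\<close>
  have "norm (a n) \<le> e * norm (1 / real n)" if n: "n \<ge> 2 * N + 1" for n
  proof -
    have "real (Suc n - n div 2) * a n = (\<Sum>i = n div 2..<Suc n. a n)" by simp
    also have "\<dots> \<le> sum a {n div 2..<Suc n}"
      by (intro sum_mono decseqD[OF dec]) auto
    also have "\<dots> < e / 2"
    proof -
      have "N \<le> n div 2" using n by linarith
      from N[OF this, of "Suc n"] show ?thesis by (simp only: real_norm_def abs_less_iff)
    qed
    finally have "real (Suc n - n div 2) * a n < e / 2" .
    moreover have "real n / 2 * a n \<le> real (Suc n - n div 2) * a n"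
      by (intro mult_right_mono nonneg) linarith
    ultimately have "real n * a n \<le> e" by simp
    thus ?thesis using n nonneg[of n] by (simp add: field_simps)
  qed
  thus "\<forall>\<^sub>F n in sequentially. norm (a n) \<le> e * norm (1 / real n)"
    unfolding eventually_sequentially by blast
qed

section \<open>The spaces \<open>W_space\<close> and \<open>W_perp\<close> and the metric G\<close>

lemma W_perp_orthogonal:
  assumes "v \<in> W_perp" and "w \<in> W_space"
  shows "v \<bullet> w = 0"
proof -
  have v: "v $ k = v $ undefined" for k
    using assms(1) unfolding W_perp_def by blast
  have "v \<bullet> w = (\<Sum>k\<in>UNIV. v $ undefined \<bullet> w $ k)"
    unfolding inner_vec_def[of v] by (intro sum.cong refl arg_cong2[where f = inner] v)
  also have "\<dots> = 0"
    using assms(2) by (simp add: W_space_def flip: inner_sum_right)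
  finally show ?thesis .
qed

lemma W_space_diff: "v \<in> W_space \<Longrightarrow> w \<in> W_space \<Longrightarrow> v - w \<in> W_space"
  by (simp add: W_space_def sum_subtractf)

lemma W_perp_diff: "v \<in> W_perp \<Longrightarrow> w \<in> W_perp \<Longrightarrow> v - w \<in> W_perp"
  unfolding W_perp_def by (simp only: mem_Collect_eq vector_minus_component) metis

lemma G_norm_sq_nonneg: "\<rho> > 0 \<Longrightarrow> c > 0 \<Longrightarrow> 0 \<le> G_norm_sq \<rho> c u"
  by (cases u) simp

lemma power2_norm_diff: "(norm (a - b))\<^sup>2 = (norm a)\<^sup>2 - 2 * (b \<bullet> a) + (norm (b::'a::real_inner))\<^sup>2"
  unfolding power2_norm_eq_inner by (simp add: inner_diff inner_commute)

text \<open>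
  Here \<open>s\<close> is a step and \<open>d\<close> its end point minus a zero of the monotone operator
  (Fejer monotonicity), or \<open>d\<close> is a step and \<open>s\<close> its difference to the preceding step
  (the step lengths decrease).
\<close>

lemma G_norm_sq_resolvent:
  fixes dw sw d\<eta> s\<eta> d\<zeta> s\<zeta> v :: "real ^ 'm::finite ^ 'k::finite"
    and dx sx :: "real ^ 'n::finite"
  assumes pos: "\<rho> > 0" "c > 0"
    and W: "dw \<in> W_space" "sw \<in> W_space" and perp: "d\<zeta> \<in> W_perp" "s\<zeta> \<in> W_perp"
    and diff: "d\<eta> - d\<zeta> = \<rho> *\<^sub>R sw" and v: "s\<eta> + s\<zeta> = \<rho> *\<^sub>R (v - dw)"
    and mono: "d\<eta> \<bullet> v + 1 / c * (sx \<bullet> dx) \<le> 0"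
  shows "G_norm_sq \<rho> c (dw, dx, d\<eta>, d\<zeta>) + G_norm_sq \<rho> c (sw, sx, s\<eta>, s\<zeta>) \<le>
         G_norm_sq \<rho> c ((dw, dx, d\<eta>, d\<zeta>) - (sw, sx, s\<eta>, s\<zeta>))"
proof -
  \<comment> \<open>\<open>B\<close> is the G inner product of s and d. Orthogonality of
    \<open>d\<zeta>\<close> to \<open>dw\<close> and of \<open>sw\<close> to \<open>s\<zeta>\<close>
    makes it equal to the left side of \<open>mono\<close>, and the square of d - s expands with
    cross term \<open>- 2 * B\<close>.\<close>
  define B where "B = \<rho> * (sw \<bullet> dw) + 1 / c * (sx \<bullet> dx) + 1 / \<rho> * (s\<eta> \<bullet> d\<eta>) + 1 / \<rho> * (s\<zeta> \<bullet> d\<zeta>)"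
  have d\<eta>: "d\<eta> = d\<zeta> + \<rho> *\<^sub>R sw" using diff by (simp add: algebra_simps)
  have o: "d\<zeta> \<bullet> dw = 0" "sw \<bullet> s\<zeta> = 0"
    using W_perp_orthogonal[OF perp(1) W(1)] W_perp_orthogonal[OF perp(2) W(2)]
    by (simp_all add: inner_commute)
  have "v = (1 / \<rho>) *\<^sub>R (s\<eta> + s\<zeta>) + dw" unfolding v using pos by simp
  hence "d\<eta> \<bullet> v = 1 / \<rho> * (d\<eta> \<bullet> s\<eta> + d\<eta> \<bullet> s\<zeta>) + d\<eta> \<bullet> dw"
    by (simp add: inner_add_right)
  also have "d\<eta> \<bullet> s\<zeta> = s\<zeta> \<bullet> d\<zeta>" unfolding d\<eta> by (simp add: inner_add_left o inner_commute[of s\<zeta>])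
  also have "d\<eta> \<bullet> dw = \<rho> * (sw \<bullet> dw)" unfolding d\<eta> by (simp add: inner_add_left o)
  finally have "B \<le> 0"
    using mono by (simp add: B_def inner_commute distrib_left)
  moreover have "G_norm_sq \<rho> c ((dw, dx, d\<eta>, d\<zeta>) - (sw, sx, s\<eta>, s\<zeta>)) =
      G_norm_sq \<rho> c (dw, dx, d\<eta>, d\<zeta>) + G_norm_sq \<rho> c (sw, sx, s\<eta>, s\<zeta>)
      - 2 * B"
    by (simp add: B_def power2_norm_diff algebra_simps add_divide_distrib diff_divide_distrib)
  ultimately show ?thesis by linarith
qed

section \<open>Convexity and the variational inequality of a proximal step\<close>

lemma closed_proper_convex_on_convexD:
  assumes "closed_proper_convex_on V f" and V: "p \<in> V" "z \<in> V"
    and fin: "f p \<noteq> \<infinity>" "f z \<noteq> \<infinity>" and t: "0 \<le> t" "t \<le> 1"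
  shows "f ((1 - t) *\<^sub>R p + t *\<^sub>R z) \<le>
         ereal ((1 - t) * real_of_ereal (f p) + t * real_of_ereal (f z))"
proof -
  have epi: "(a, real_of_ereal (f a)) \<in> ereal_epigraph V f" if "a \<in> V" "f a \<noteq> \<infinity>" for a
    using assms(1) that
    by (auto simp: ereal_epigraph_def closed_proper_convex_on_def ereal_real)
  have "(1 - t) *\<^sub>R (p, real_of_ereal (f p)) + t *\<^sub>R (z, real_of_ereal (f z)) \<in> ereal_epigraph V f"
    using assms(1) epi V fin t
    unfolding closed_proper_convex_on_def by (intro convexD) auto
  thus ?thesis by (simp add: ereal_epigraph_def)
qed

text \<open>Divide by \<open>t\<close> and let \<open>t\<close> tend to 0 from the right. This turns
  minimality along a segment into a first-order condition.\<close>

lemma nonneg_of_quadratic_nonneg: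
  fixes a q :: real
  assumes "\<And>t. 0 < t \<Longrightarrow> t \<le> 1 \<Longrightarrow> 0 \<le> t * a + t\<^sup>2 * q"
  shows "0 \<le> a"
proof (rule tendsto_lowerbound)
  show "((\<lambda>t. a + t * q) \<longlongrightarrow> a) (at_right 0)"
    by (auto intro!: tendsto_eq_intros)
  have "0 \<le> a + t * q" if "t \<in> {0<..<1}" for t
  proof -
    have "0 \<le> t * (a + t * q)"
      using assms[of t] that by (simp add: algebra_simps power2_eq_square)
    thus ?thesis using that by (simp add: zero_le_mult_iff)
  qed
  thus "\<forall>\<^sub>F t in at_right 0. 0 \<le> a + t * q"
    by (auto intro!: eventually_at_rightI[of 0 1])
qed simp

text \<open>First-order optimality without subgradients: \<open>p\<close> is compared with the
  points \<open>p + t (z - p)\<close>. Convexity bounds \<open>f\<close> there by the chord, the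
  quadratic terms expand exactly, and the coefficient of \<open>t\<close> must be
  nonnegative.\<close>

lemma prox_variational_inequality:
  fixes f :: "'a::euclidean_space \<Rightarrow> ereal" and A :: "'a \<Rightarrow> 'b::real_inner"
  assumes cpc: "closed_proper_convex_on V f" and X: "X \<subseteq> V" "convex X" and A: "linear A"
    and min: "is_arg_min (\<lambda>z. f z + ereal (\<alpha> * (norm (A z - r))\<^sup>2 + \<beta> * (norm (z - s))\<^sup>2)) (\<lambda>z. z \<in> X) p"
    and z: "z \<in> X" "f z \<noteq> \<infinity>"
  shows "f p \<noteq> \<infinity>"
    and "real_of_ereal (f p) \<le> real_of_ereal (f z) +
           2 * \<alpha> * ((A p - r) \<bullet> A (z - p)) + 2 * \<beta> * ((p - s) \<bullet> (z - p))"
proof -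
  define g where "g z = \<alpha> * (norm (A z - r))\<^sup>2 + \<beta> * (norm (z - s))\<^sup>2" for z
  have p: "p \<in> X" using min by (simp add: is_arg_min_def)
  have le: "f p + ereal (g p) \<le> f y + ereal (g y)" if "y \<in> X" for y
    using min that by (auto simp: is_arg_min_def g_def not_less)
  show fp: "f p \<noteq> \<infinity>"
    using le[OF z(1)] z(2) by auto
  define P where "P = real_of_ereal (f p)"
  have P: "f p = ereal P"
    using fp cpc p X(1) by (auto simp: P_def closed_proper_convex_on_def ereal_real)
  define Z where "Z = real_of_ereal (f z)"
  \<comment> \<open>The factor of \<open>t\<close> is the derivative of \<open>g\<close> at
    \<open>p\<close> in direction \<open>d\<close>.\<close>
  have g: "g (p + t *\<^sub>R d) = g p + t * (2 * \<alpha> * ((A p - r) \<bullet> A d) + 2 * \<beta> * ((p - s) \<bullet> d))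
      + t\<^sup>2 * (\<alpha> * (norm (A d))\<^sup>2 + \<beta> * (norm d)\<^sup>2)" for t d
  proof -
    have *: "(norm (a + t *\<^sub>R e))\<^sup>2 = (norm a)\<^sup>2 + 2 * t * (a \<bullet> e) + t\<^sup>2 * (norm e)\<^sup>2"
      for a e :: "'c::real_inner"
      unfolding power2_norm_eq_inner
      by (simp add: inner_add inner_commute power2_eq_square algebra_simps)
    have "A (p + t *\<^sub>R d) - r = (A p - r) + t *\<^sub>R A d"
      by (simp add: linear_add[OF A] linear_scale[OF A])
    moreover have "p + t *\<^sub>R d - s = (p - s) + t *\<^sub>R d" by simp
    ultimately show ?thesis unfolding g_def by (simp only: *) (simp add: algebra_simps)
  qed
  let ?l = "2 * \<alpha> * ((A p - r) \<bullet> A (z - p)) + 2 * \<beta> * ((p - s) \<bullet> (z - p))"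
  have "0 \<le> Z - P + ?l"
  proof (rule nonneg_of_quadratic_nonneg)
    fix t :: real assume t: "0 < t" "t \<le> 1"
    have seg: "(1 - t) *\<^sub>R p + t *\<^sub>R z = p + t *\<^sub>R (z - p)" by (simp add: algebra_simps)
    have "p + t *\<^sub>R (z - p) \<in> X"
      using convexD_alt[OF X(2) p z(1), of t] t seg by simp
    from le[OF this] have "ereal (P + g p) \<le> f (p + t *\<^sub>R (z - p)) + ereal (g (p + t *\<^sub>R (z - p)))"
      by (simp add: P)
    also have "f (p + t *\<^sub>R (z - p)) \<le> ereal ((1 - t) * P + t * Z)"
      using closed_proper_convex_on_convexD[OF cpc _ _ fp z(2), of t] p z(1) X(1) t
      unfolding seg P_def Z_def by auto
    finally have "P + g p \<le> (1 - t) * P + t * Z + g (p + t *\<^sub>R (z - p))"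
      by (simp add: add_right_mono)
    thus "0 \<le> t * (Z - P + ?l) + t\<^sup>2 * (\<alpha> * (norm (A (z - p)))\<^sup>2 + \<beta> * (norm (z - p))\<^sup>2)"
      unfolding g by (simp add: algebra_simps)
  qed
  thus "real_of_ereal (f p) \<le> real_of_ereal (f z) +
      2 * \<alpha> * ((A p - r) \<bullet> A (z - p)) + 2 * \<beta> * ((p - s) \<bullet> (z - p))"
    by (simp add: P_def Z_def)
qed

section \<open>Block decomposition\<close>

lemma linear_block: "linear (block b k)"
  by (rule linearI) (auto simp: block_def vec_eq_iff)

lemma sum_block: "(\<Sum>k\<in>UNIV. block b k x) = x"
  by (simp add: vec_eq_iff block_def)

lemma sum_block_inner: "(\<Sum>k\<in>UNIV. block b k x \<bullet> block b k z) = x \<bullet> z"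
proof -
  have "block b k x \<bullet> block b k z = block b k x \<bullet> z" for k
    by (auto simp: inner_vec_def block_def intro!: sum.cong)
  thus ?thesis by (simp add: sum_block flip: inner_sum_left)
qed

text \<open>The block diagonal matrix with blocks E_1, ..., E_K as a map into (R^m)^K. It is what
  the overview calls \<open>E\<close>.\<close>

definition block_image :: "('n::finite \<Rightarrow> 'k::finite) \<Rightarrow> real ^ 'n ^ 'm::finite \<Rightarrow> real ^ 'n \<Rightarrow> real ^ 'm ^ 'k"
  where "block_image b E x = (\<chi> k. E *v block b k x)"

lemma block_image_diff: "block_image b E (x - z) = block_image b E x - block_image b E z"
  by (simp add: block_image_def vec_eq_iff linear_diff[OF linear_block] matrix_vector_mult_diff_distrib)

lemma sum_block_image: "(\<Sum>k\<in>UNIV. block_image b E x $ k) = E *v x"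
proof -
  have "(\<Sum>k\<in>UNIV. E *v block b k x) = E *v (\<Sum>k\<in>UNIV. block b k x)"
    by (simp add: linear_sum[OF matrix_vector_mul_linear])
  thus ?thesis by (simp add: block_image_def sum_block)
qed

section \<open>Real-valued objective and saddle point\<close>

text \<open>A stand-in in which values may be subtracted. \<open>real_of_ereal\<close> sends
  infinite values to 0, so the inequalities below speak only of points whose block values are all
  finite.\<close>

definition real_objective :: "('n::finite \<Rightarrow> 'k::finite) \<Rightarrow> ('k \<Rightarrow> real ^ 'n \<Rightarrow> ereal) \<Rightarrow> real ^ 'n \<Rightarrow> real"
  where "real_objective b f x = (\<Sum>k\<in>UNIV. real_of_ereal (f k (block b k x)))"

text \<open>In ereal addition \<open>\<infinity>\<close> absorbs even \<open>-\<infinity>\<close>,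
  so a single infinite block already makes the sum infinite.\<close>

lemma objective_finite_iff:
  "objective b f z \<noteq> \<infinity> \<longleftrightarrow> (\<forall>k. f k (block b k z) \<noteq> \<infinity>)"
  by (auto simp: objective_def sum_Pinfty)

lemma objective_eq_real_objective:
  assumes "problem_data b f X" and "z \<in> block_product b X" and "\<And>k. f k (block b k z) \<noteq> \<infinity>"
  shows "objective b f z = ereal (real_objective b f z)"
proof -
  have "f k (block b k z) = ereal (real_of_ereal (f k (block b k z)))" for k
    using assms unfolding problem_data_def closed_proper_convex_on_def block_product_def
    by (auto simp: ereal_real subset_iff)
  hence "objective b f z = (\<Sum>k\<in>UNIV. ereal (real_of_ereal (f k (block b k z))))"
    unfolding objective_def by (intro sum.cong) auto
  thus ?thesis by (simp add: real_objective_def)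
qed

lemma saddle_point_exists:
  assumes pd: "problem_data b f X" and sa: "standing_assumption b f X E 0"
  obtains xb yb where "xb \<in> block_product b X" and "\<And>k. f k (block b k xb) \<noteq> \<infinity>" and "E *v xb = 0"
    and "\<And>z. z \<in> block_product b X \<Longrightarrow> (\<And>k. f k (block b k z) \<noteq> \<infinity>) \<Longrightarrow>
           real_objective b f xb \<le> real_objective b f z + (E *v z) \<bullet> yb"
proof -
  \<comment> \<open>Either alternative of the constraint qualification supplies a point of the
    product set with finite objective; comparison with it makes the objective finite at
    \<open>xb\<close>.\<close>
  obtain x0 where x0: "x0 \<in> block_product b X" "objective b f x0 \<noteq> \<infinity>"
    using sa interior_subset unfolding standing_assumption_def effective_domain_def by fastforce
  obtain xb yb where
    xb: "is_arg_min (\<lambda>x. lagrangian b f E 0 x yb) (\<lambda>x. x \<in> block_product b X) xb" and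
    yb: "is_arg_max (\<lambda>y. lagrangian b f E 0 xb y) (\<lambda>y. True) yb"
    using sa unfolding standing_assumption_def by blast
  have X: "xb \<in> block_product b X" using xb by (simp add: is_arg_min_def)
  have le: "objective b f xb + ereal ((E *v xb) \<bullet> yb) \<le> objective b f z + ereal ((E *v z) \<bullet> yb)"
    if "z \<in> block_product b X" for z
    using xb that by (auto simp: is_arg_min_def lagrangian_def not_less)
  have "objective b f xb \<noteq> \<infinity>" using le[OF x0(1)] x0(2) by auto
  hence fin: "f k (block b k xb) \<noteq> \<infinity>" for k using objective_finite_iff by blast
  note obj = objective_eq_real_objective[OF pd X fin]
  \<comment> \<open>The Lagrangian is affine in the multiplier with slope \<open>E *v xb\<close>. A
    move along the slope would increase it by the squared norm of the slope, so the maximum forces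
    feasibility.\<close>
  have "lagrangian b f E 0 xb (yb + E *v xb) \<le> lagrangian b f E 0 xb yb"
    using yb by (auto simp: is_arg_max_def not_less)
  hence "(E *v xb) \<bullet> (E *v xb) \<le> 0"
    by (simp add: lagrangian_def obj inner_add_right)
  hence zero: "E *v xb = 0" by (metis inner_eq_zero_iff inner_ge_zero order_antisym)
  have "real_objective b f xb \<le> real_objective b f z + (E *v z) \<bullet> yb"
    if z: "z \<in> block_product b X" "\<And>k. f k (block b k z) \<noteq> \<infinity>" for z
    using le[OF z(1)] by (simp add: obj zero objective_eq_real_objective[OF pd z])
  from that[OF X fin zero this] show thesis .
qed

section \<open>ADA as a proximal point step\<close>

text \<open>The x-component of the proximal point step: the inequality for a single prox problem,
  used in each block with \<open>\<alpha> = \<rho> / 4\<close> and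
  \<open>\<beta> = 1 / (2 * c)\<close>, and summed. The finiteness claim lets every iterate of
  positive index serve as a test point; \<open>x 0\<close> may have infinite objective.\<close>

lemma ada_variational_inequality:
  assumes pd: "problem_data b f X" and ada: "ada b f X E \<rho> c w x \<eta> \<zeta> y"
    and pos: "\<rho> > 0" "c > 0"
    and z: "z \<in> block_product b X" "\<And>k. f k (block b k z) \<noteq> \<infinity>"
  shows "f k (block b k (x (Suc \<nu>))) \<noteq> \<infinity>"
    and "real_objective b f (x (Suc \<nu>)) \<le> real_objective b f z
           + \<eta> (Suc \<nu>) \<bullet> block_image b E (z - x (Suc \<nu>))
           + 1 / c * ((x (Suc \<nu>) - x \<nu>) \<bullet> (z - x (Suc \<nu>)))"
proof -
  let ?x = "\<lambda>k. block b k (x (Suc \<nu>))"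
  have min: "is_arg_min (\<lambda>z. f k z + ereal (\<rho> / 4 * (norm (E *v z - (w \<nu> $ k - (2 / \<rho>) *\<^sub>R y \<nu> $ k)))\<^sup>2
      + 1 / (2 * c) * (norm (z - block b k (x \<nu>)))\<^sup>2)) (\<lambda>z. z \<in> X k) (?x k)"
    and \<eta>: "\<eta> (Suc \<nu>) $ k = y \<nu> $ k + (\<rho> / 2) *\<^sub>R (E *v ?x k - w \<nu> $ k)" for k
    using ada unfolding ada_def by (auto simp: algebra_simps)
  have zk: "block b k z \<in> X k" for k using z by (simp add: block_product_def)
  have cpc: "closed_proper_convex_on (block_space b k) (f k)"
    and X: "X k \<subseteq> block_space b k" "convex (X k)" for k
    using pd by (auto simp: problem_data_def)
  note vi = prox_variational_inequality[OF cpc X matrix_vector_mul_linear min zk z(2)]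
  show "f k (?x k) \<noteq> \<infinity>" by (rule vi(1))
  \<comment> \<open>The derivative of the penalty term is paired with exactly the new multiplier, by
    the update rule for \<open>\<eta>\<close>.\<close>
  have "(\<rho> / 2) *\<^sub>R (E *v ?x k - (w \<nu> $ k - (2 / \<rho>) *\<^sub>R y \<nu> $ k)) = \<eta> (Suc \<nu>) $ k" for k
    using pos by (simp add: \<eta> algebra_simps)
  hence *: "2 * (\<rho> / 4) * ((E *v ?x k - (w \<nu> $ k - (2 / \<rho>) *\<^sub>R y \<nu> $ k)) \<bullet> v) = \<eta> (Suc \<nu>) $ k \<bullet> v" for k v
    by (simp flip: inner_scaleR_left)
  have le: "real_of_ereal (f k (?x k)) \<le> real_of_ereal (f k (block b k z))
     + \<eta> (Suc \<nu>) $ k \<bullet> block_image b E (z - x (Suc \<nu>)) $ k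
     + 1 / c * (block b k (x (Suc \<nu>) - x \<nu>) \<bullet> block b k (z - x (Suc \<nu>)))" for k
    using vi(2)[of k, unfolded *]
    by (simp add: block_image_def linear_diff[OF linear_block])
  have "(\<Sum>k\<in>UNIV. real_of_ereal (f k (?x k))) \<le> (\<Sum>k\<in>UNIV. real_of_ereal (f k (block b k z))
     + \<eta> (Suc \<nu>) $ k \<bullet> block_image b E (z - x (Suc \<nu>)) $ k
     + 1 / c * (block b k (x (Suc \<nu>) - x \<nu>) \<bullet> block b k (z - x (Suc \<nu>))))"
    by (intro sum_mono le)
  thus "real_objective b f (x (Suc \<nu>)) \<le> real_objective b f z
           + \<eta> (Suc \<nu>) \<bullet> block_image b E (z - x (Suc \<nu>))
           + 1 / c * ((x (Suc \<nu>) - x \<nu>) \<bullet> (z - x (Suc \<nu>)))"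
    unfolding sum.distrib sum_distrib_left[symmetric] sum_block_inner real_objective_def
      inner_vec_def[of "\<eta> (Suc \<nu>)"] .
qed

text \<open>Puts the updates into the form that \<open>G_norm_sq_resolvent\<close> requires. The
  fourth claim is the w-component of the proximal step. The fifth holds the components of
  \<open>\<omega>\<close> and \<open>\<zeta>\<close> together, since
  \<open>\<eta> + \<zeta> = \<omega> + 2 \<zeta>\<close>; projection onto \<open>W_space\<close> and
  \<open>W_perp\<close> would separate them.\<close>

lemma ada_spaces:
  fixes E :: "real ^ 'n::finite ^ 'm::finite" and w \<eta> \<zeta> y :: "nat \<Rightarrow> real ^ 'm ^ 'k::finite"
  assumes ada: "ada b f X E \<rho> c w x \<eta> \<zeta> y" and \<rho>: "\<rho> > 0"
  shows "w \<nu> \<in> W_space" and "\<zeta> \<nu> \<in> W_perp" and "\<eta> \<nu> - \<zeta> \<nu> \<in> W_space"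
    and "\<eta> (Suc \<nu>) - \<zeta> (Suc \<nu>) = \<rho> *\<^sub>R (w (Suc \<nu>) - w \<nu>)"
    and "(\<eta> (Suc \<nu>) - \<eta> \<nu>) + (\<zeta> (Suc \<nu>) - \<zeta> \<nu>) =
           \<rho> *\<^sub>R (block_image b E (x (Suc \<nu>)) - w (Suc \<nu>))"
    and "x \<nu> \<in> block_product b X"
proof -
  note ada_iter = ada[unfolded ada_def, THEN conjunct2, THEN conjunct2, THEN conjunct2,
      THEN conjunct2, rule_format]
  \<comment> \<open>At index 0 this comes from \<open>S_set\<close> and the formula for the
    projection, afterwards from the update.\<close>
  have avg: "\<zeta> \<nu> = (\<chi> k. (1 / real CARD('k)) *\<^sub>R (\<Sum>j\<in>UNIV. \<eta> \<nu> $ j))" for \<nu>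
  proof (cases \<nu>)
    case 0
    have "closest_point W_perp (\<eta> 0) = \<zeta> 0"
      using ada by (simp add: ada_def S_set_def)
    thus ?thesis unfolding 0 closest_point_W_perp by simp
  next
    case (Suc n)
    show ?thesis unfolding Suc using ada_iter[where \<nu> = n] by (simp add: vec_eq_iff)
  qed
  show perp: "\<zeta> \<nu> \<in> W_perp" for \<nu> unfolding W_perp_def by (subst avg)+ simp
  show W: "\<eta> \<nu> - \<zeta> \<nu> \<in> W_space" for \<nu>
    unfolding W_space_def
    by (subst avg) (simp add: sum_subtractf sum_constant_scaleR del: sum_constant)
  show w: "\<eta> (Suc \<nu>) - \<zeta> (Suc \<nu>) = \<rho> *\<^sub>R (w (Suc \<nu>) - w \<nu>)" for \<nu>
    unfolding vec_eq_iff[of "\<eta> (Suc \<nu>) - \<zeta> (Suc \<nu>)"]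
    using ada_iter[where \<nu> = \<nu>] \<rho> by simp
  show "w \<nu> \<in> W_space"
  proof (induction \<nu>)
    case 0
    show ?case using ada by (simp add: ada_def)
  next
    case (Suc \<nu>)
    have "w (Suc \<nu>) = w \<nu> + (1 / \<rho>) *\<^sub>R (\<eta> (Suc \<nu>) - \<zeta> (Suc \<nu>))"
      unfolding w using \<rho> by simp
    thus ?case using Suc W[of "Suc \<nu>"]
      by (simp add: W_space_def sum.distrib flip: scaleR_sum_right)
  qed
  have y: "y \<nu> = (1/2) *\<^sub>R (\<eta> \<nu> + \<zeta> \<nu>)" for \<nu>
  proof (cases \<nu>)
    case 0
    show ?thesis using ada by (simp add: 0 ada_def)
  next
    case (Suc n)
    show ?thesis unfolding Suc vec_eq_iff using ada_iter[where \<nu> = n] by simp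
  qed
  have "\<eta> (Suc \<nu>) = y \<nu> + (\<rho> / 2) *\<^sub>R (block_image b E (x (Suc \<nu>)) - w \<nu>)"
    unfolding vec_eq_iff using ada_iter[where \<nu> = \<nu>] by (simp add: block_image_def)
  hence "2 *\<^sub>R \<eta> (Suc \<nu>) = \<eta> \<nu> + \<zeta> \<nu> + \<rho> *\<^sub>R (block_image b E (x (Suc \<nu>)) - w \<nu>)"
    by (simp add: y scaleR_add_right)
  \<comment> \<open>Subtracting the w-update turns one copy of \<open>\<eta> (Suc \<nu>)\<close>
    into \<open>\<zeta> (Suc \<nu>)\<close> and \<open>w \<nu>\<close> into
    \<open>w (Suc \<nu>)\<close>, which makes the step implicit.\<close>
  hence "2 *\<^sub>R \<eta> (Suc \<nu>) - (\<eta> \<nu> + \<zeta> \<nu>) - (\<eta> (Suc \<nu>) - \<zeta> (Suc \<nu>)) =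
      \<rho> *\<^sub>R (block_image b E (x (Suc \<nu>)) - w \<nu>) - \<rho> *\<^sub>R (w (Suc \<nu>) - w \<nu>)"
    unfolding w by simp
  thus "(\<eta> (Suc \<nu>) - \<eta> \<nu>) + (\<zeta> (Suc \<nu>) - \<zeta> \<nu>) =
      \<rho> *\<^sub>R (block_image b E (x (Suc \<nu>)) - w (Suc \<nu>))"
    by (simp add: scaleR_2 scaleR_diff_right) (simp add: algebra_simps)
  show "x \<nu> \<in> block_product b X"
  proof (cases \<nu>)
    case 0
    show ?thesis using ada by (simp add: 0 ada_def)
  next
    case (Suc n)
    show ?thesis
      using ada_iter[where \<nu> = n, THEN conjunct1] by (simp add: Suc is_arg_min_def block_product_def)
  qed
qed

section \<open>Fejer monotonicity and decreasing step lengths\<close>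

text \<open>\<open>us\<close> is the zero of the operator given by the saddle point: its w-part lies
  in \<open>W_space\<close> because \<open>E *v xb = 0\<close>, and equal multiplier parts mean
  \<open>\<omega> = 0\<close>. The resolvent lemma applies to d = \<open>u (Suc \<nu>) - us\<close>
  and s = \<open>u (Suc \<nu>) - u \<nu>\<close>.\<close>

lemma ada_fejer:
  fixes E :: "real ^ 'n::finite ^ 'm::finite" and w \<eta> \<zeta> y :: "nat \<Rightarrow> real ^ 'm ^ 'k::finite"
  assumes pd: "problem_data b f X" and ada: "ada b f X E \<rho> c w x \<eta> \<zeta> y" and pos: "\<rho> > 0" "c > 0"
    and xb: "xb \<in> block_product b X" "\<And>k. f k (block b k xb) \<noteq> \<infinity>" "E *v xb = 0"
    and saddle: "\<And>z. z \<in> block_product b X \<Longrightarrow> (\<And>k. f k (block b k z) \<noteq> \<infinity>) \<Longrightarrow>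
           real_objective b f xb \<le> real_objective b f z + (E *v z) \<bullet> yb"
    and u: "\<And>\<nu>. u \<nu> = (w \<nu>, x \<nu>, \<eta> \<nu>, \<zeta> \<nu>)"
    and us: "us = (block_image b E xb, xb, \<chi> k. yb, \<chi> k. yb)"
  shows "G_norm_sq \<rho> c (u (Suc \<nu>) - us) + G_norm_sq \<rho> c (u (Suc \<nu>) - u \<nu>) \<le> G_norm_sq \<rho> c (u \<nu> - us)"
proof -
  note sp = ada_spaces[OF ada pos(1)]
  note vi = ada_variational_inequality[OF pd ada pos]
  let ?A = "block_image b E :: _ \<Rightarrow> real ^ 'm ^ 'k"
  let ?ys = "(\<chi> k. yb) :: real ^ 'm ^ 'k"
  have ys: "?ys \<bullet> ?A z = (E *v z) \<bullet> yb" for z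
    by (simp add: inner_vec_def[of ?ys] inner_commute[of _ yb] flip: sum_block_image[of b] inner_sum_right)
  have "real_objective b f xb \<le> real_objective b f (x (Suc \<nu>)) + ?ys \<bullet> ?A (x (Suc \<nu>))"
    unfolding ys by (rule saddle[OF sp(6) vi(1)[OF xb(1,2)]])
  \<comment> \<open>Add the saddle inequality at the new iterate to the variational inequality
    tested at \<open>xb\<close>; the objective values cancel.\<close>
  hence "\<eta> (Suc \<nu>) \<bullet> ?A (x (Suc \<nu>) - xb) - ?ys \<bullet> ?A (x (Suc \<nu>))
      + 1 / c * ((x (Suc \<nu>) - x \<nu>) \<bullet> (x (Suc \<nu>) - xb)) \<le> 0"
    using vi(2)[OF xb(1,2), of \<nu>]
    by (simp add: block_image_diff inner_diff_right right_diff_distrib diff_divide_distrib)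
  moreover have "?ys \<bullet> ?A xb = 0" by (simp add: ys xb(3))
  ultimately have mono: "(\<eta> (Suc \<nu>) - ?ys) \<bullet> (?A (x (Suc \<nu>)) - ?A xb)
      + 1 / c * ((x (Suc \<nu>) - x \<nu>) \<bullet> (x (Suc \<nu>) - xb)) \<le> 0"
    by (simp add: block_image_diff inner_diff_left inner_diff_right)
  have "?A xb \<in> W_space" using xb(3) by (simp add: W_space_def sum_block_image)
  moreover have "?ys \<in> W_perp" by (simp add: W_perp_def)
  ultimately have "G_norm_sq \<rho> c (w (Suc \<nu>) - ?A xb, x (Suc \<nu>) - xb, \<eta> (Suc \<nu>) - ?ys, \<zeta> (Suc \<nu>) - ?ys)
     + G_norm_sq \<rho> c (w (Suc \<nu>) - w \<nu>, x (Suc \<nu>) - x \<nu>, \<eta> (Suc \<nu>) - \<eta> \<nu>, \<zeta> (Suc \<nu>) - \<zeta> \<nu>)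
    \<le> G_norm_sq \<rho> c ((w (Suc \<nu>) - ?A xb, x (Suc \<nu>) - xb, \<eta> (Suc \<nu>) - ?ys, \<zeta> (Suc \<nu>) - ?ys)
     - (w (Suc \<nu>) - w \<nu>, x (Suc \<nu>) - x \<nu>, \<eta> (Suc \<nu>) - \<eta> \<nu>, \<zeta> (Suc \<nu>) - \<zeta> \<nu>))"
    using sp(4)[of \<nu>] sp(5)[of \<nu>]
    by (intro G_norm_sq_resolvent[OF pos _ _ _ _ _ _ mono] W_space_diff W_perp_diff sp(1,2)) simp_all
  thus ?thesis by (simp add: u us)
qed

lemma ada_step_antimono:
  fixes E :: "real ^ 'n::finite ^ 'm::finite" and w \<eta> \<zeta> y :: "nat \<Rightarrow> real ^ 'm ^ 'k::finite"
  assumes pd: "problem_data b f X" and ada: "ada b f X E \<rho> c w x \<eta> \<zeta> y" and pos: "\<rho> > 0" "c > 0"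
    and xb: "xb \<in> block_product b X" "\<And>k. f k (block b k xb) \<noteq> \<infinity>"
    and u: "\<And>\<nu>. u \<nu> = (w \<nu>, x \<nu>, \<eta> \<nu>, \<zeta> \<nu>)"
  shows "G_norm_sq \<rho> c (u (Suc (Suc \<nu>)) - u (Suc \<nu>)) \<le> G_norm_sq \<rho> c (u (Suc \<nu>) - u \<nu>)"
proof -
  note sp = ada_spaces[OF ada pos(1)]
  note vi = ada_variational_inequality[OF pd ada pos]
  let ?A = "block_image b E :: _ \<Rightarrow> real ^ 'm ^ 'k"
  define dw dx d\<eta> d\<zeta> where d: "dw = w (Suc (Suc \<nu>)) - w (Suc \<nu>)" "dx = x (Suc (Suc \<nu>)) - x (Suc \<nu>)"
    "d\<eta> = \<eta> (Suc (Suc \<nu>)) - \<eta> (Suc \<nu>)" "d\<zeta> = \<zeta> (Suc (Suc \<nu>)) - \<zeta> (Suc \<nu>)"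
  define sw sx s\<eta> s\<zeta> where s: "sw = dw - (w (Suc \<nu>) - w \<nu>)" "sx = dx - (x (Suc \<nu>) - x \<nu>)"
    "s\<eta> = d\<eta> - (\<eta> (Suc \<nu>) - \<eta> \<nu>)" "s\<zeta> = d\<zeta> - (\<zeta> (Suc \<nu>) - \<zeta> \<nu>)"
  define v where "v = ?A (x (Suc (Suc \<nu>))) - ?A (x (Suc \<nu>))"
  have neg: "x (Suc \<nu>) - x (Suc (Suc \<nu>)) = - dx" "?A (x (Suc \<nu>) - x (Suc (Suc \<nu>))) = - v"
    by (simp_all add: d v_def block_image_diff)
  \<comment> \<open>Two consecutive iterations are tested at each other's result. Adding the
    inequalities cancels the objective values and leaves monotonicity. Both test points have
    positive index, so their values are finite.\<close>
  have "real_objective b f (x (Suc \<nu>)) \<le> real_objective b f (x (Suc (Suc \<nu>)))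
      + \<eta> (Suc \<nu>) \<bullet> v + 1 / c * ((x (Suc \<nu>) - x \<nu>) \<bullet> dx)"
    using vi(2)[OF sp(6) vi(1)[OF xb], of \<nu> "Suc \<nu>"]
    by (simp only: block_image_diff v_def d)
  moreover have "real_objective b f (x (Suc (Suc \<nu>))) \<le> real_objective b f (x (Suc \<nu>))
      - \<eta> (Suc (Suc \<nu>)) \<bullet> v - 1 / c * (dx \<bullet> dx)"
    using vi(2)[OF sp(6) vi(1)[OF xb], of "Suc \<nu>" \<nu>]
    unfolding neg(2) unfolding neg(1) d(2)[symmetric] by simp
  ultimately have "d\<eta> \<bullet> v + 1 / c * (sx \<bullet> dx) \<le> 0"
    unfolding s(2) d(3) inner_diff_left right_diff_distrib by linarith
  moreover have "s\<eta> + s\<zeta> = \<rho> *\<^sub>R (v - dw)"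
  proof -
    have "s\<eta> + s\<zeta> = (d\<eta> + d\<zeta>) - ((\<eta> (Suc \<nu>) - \<eta> \<nu>) + (\<zeta> (Suc \<nu>) - \<zeta> \<nu>))" by (simp add: s)
    also have "\<dots> = \<rho> *\<^sub>R (v - dw)"
      unfolding d(3,4) sp(5) by (simp add: v_def d(1) scaleR_diff_right)
    finally show ?thesis .
  qed
  moreover have "d\<eta> - d\<zeta> = \<rho> *\<^sub>R sw"
  proof -
    have "d\<eta> - d\<zeta> = (\<eta> (Suc (Suc \<nu>)) - \<zeta> (Suc (Suc \<nu>))) - (\<eta> (Suc \<nu>) - \<zeta> (Suc \<nu>))"
      by (simp add: d)
    also have "\<dots> = \<rho> *\<^sub>R sw"
      unfolding sp(4) by (simp add: s d scaleR_diff_right scaleR_add_right)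
    finally show ?thesis .
  qed
  moreover have "dw \<in> W_space" "sw \<in> W_space" "d\<zeta> \<in> W_perp" "s\<zeta> \<in> W_perp"
    unfolding d s by (intro W_space_diff W_perp_diff sp(1,2))+
  ultimately have "G_norm_sq \<rho> c (dw, dx, d\<eta>, d\<zeta>) + G_norm_sq \<rho> c (sw, sx, s\<eta>, s\<zeta>) \<le>
         G_norm_sq \<rho> c ((dw, dx, d\<eta>, d\<zeta>) - (sw, sx, s\<eta>, s\<zeta>))"
    by (intro G_norm_sq_resolvent[OF pos]) simp_all
  moreover have "(dw, dx, d\<eta>, d\<zeta>) = u (Suc (Suc \<nu>)) - u (Suc \<nu>)"
    "(dw, dx, d\<eta>, d\<zeta>) - (sw, sx, s\<eta>, s\<zeta>) = u (Suc \<nu>) - u \<nu>"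
    by (simp_all add: u d s)
  ultimately show ?thesis
    using G_norm_sq_nonneg[OF pos, of "(sw, sx, s\<eta>, s\<zeta>)"] by simp
qed

section \<open>Constraint residual and convergence rates\<close>

text \<open>Sum the fifth claim of \<open>ada_spaces\<close> over the blocks: everything in
  \<open>W_space\<close> drops out, and twice the summed increment of \<open>\<zeta>\<close> equals
  \<open>\<rho>\<close> times the residual. The increment has equal components, so the residual is
  \<open>2 * CARD('k) / \<rho>\<close> times any one of them, here the one at the arbitrary index
  \<open>undefined\<close>.\<close>

lemma ada_constraint_bound:
  fixes E :: "real ^ 'n::finite ^ 'm::finite" and w \<eta> \<zeta> y :: "nat \<Rightarrow> real ^ 'm ^ 'k::finite"
  assumes ada: "ada b f X E \<rho> c w x \<eta> \<zeta> y" and \<rho>: "\<rho> > 0"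
  shows "(norm (E *v x (Suc \<nu>)))\<^sup>2 \<le> (2 * real CARD('k) / \<rho>)\<^sup>2 * (norm (\<zeta> (Suc \<nu>) - \<zeta> \<nu>))\<^sup>2"
proof -
  note sp = ada_spaces[OF ada \<rho>]
  let ?d = "\<zeta> (Suc \<nu>) - \<zeta> \<nu>"
  have "?d $ k = ?d $ undefined" for k
    using W_perp_diff[OF sp(2) sp(2), of "Suc \<nu>" \<nu>] unfolding W_perp_def by blast
  hence "(\<Sum>k\<in>UNIV. ?d $ k) = (\<Sum>k\<in>(UNIV :: 'k set). ?d $ undefined)"
    by (rule sum.cong[OF refl])
  hence sum_d: "(\<Sum>k\<in>UNIV. ?d $ k) = real CARD('k) *\<^sub>R ?d $ undefined"
    by (simp only: sum_constant_scaleR)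
  have "(\<Sum>k\<in>UNIV. ((\<eta> (Suc \<nu>) - \<zeta> (Suc \<nu>)) - (\<eta> \<nu> - \<zeta> \<nu>) + 2 *\<^sub>R ?d) $ k) =
      (\<Sum>k\<in>UNIV. (\<rho> *\<^sub>R (block_image b E (x (Suc \<nu>)) - w (Suc \<nu>))) $ k)"
    unfolding sp(5)[symmetric] by (simp add: algebra_simps scaleR_2)
  hence "2 *\<^sub>R (\<Sum>k\<in>UNIV. ?d $ k) = \<rho> *\<^sub>R (E *v x (Suc \<nu>))"
    using sp(3)[of "Suc \<nu>"] sp(3)[of \<nu>] sp(1)[of "Suc \<nu>"] sum_block_image[of b E "x (Suc \<nu>)"]
    unfolding vector_add_component vector_minus_component vector_scaleR_component
      sum.distrib sum_subtractf W_space_def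
    by (simp add: sum_subtractf flip: scaleR_sum_right)
  hence "(1 / \<rho>) *\<^sub>R \<rho> *\<^sub>R (E *v x (Suc \<nu>)) = (1 / \<rho>) *\<^sub>R 2 *\<^sub>R real CARD('k) *\<^sub>R ?d $ undefined"
    unfolding sum_d by simp
  hence "E *v x (Suc \<nu>) = (2 * real CARD('k) / \<rho>) *\<^sub>R ?d $ undefined"
    using \<rho> by simp
  hence "norm (E *v x (Suc \<nu>)) \<le> (2 * real CARD('k) / \<rho>) * norm ?d"
    using \<rho> Finite_Cartesian_Product.norm_nth_le[of ?d undefined]
    by (simp add: divide_right_mono mult_left_mono del: vector_minus_component)
  thus ?thesis unfolding power_mult_distrib[symmetric]
    by (rule power_mono) simp
qed

theorem theorem2p4:
  fixes b :: "'n::finite \<Rightarrow> 'k::finite"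
    and f :: "'k \<Rightarrow> real ^ 'n \<Rightarrow> ereal"
    and X :: "'k \<Rightarrow> (real ^ 'n) set"
    and E :: "real ^ 'n ^ 'm::finite"
    and \<rho> c :: real
    and w \<eta> \<zeta> y :: "nat \<Rightarrow> real ^ 'm ^ 'k"
    and x :: "nat \<Rightarrow> real ^ 'n"
    and u :: "nat \<Rightarrow> (real ^ 'm ^ 'k) \<times> (real ^ 'n) \<times> (real ^ 'm ^ 'k) \<times> (real ^ 'm ^ 'k)"
  assumes "problem_data b f X"
    and "standing_assumption b f X E 0"
    and "\<rho> > 0" and "c > 0"
    and "ada b f X E \<rho> c w x \<eta> \<zeta> y"
    and "\<And>\<nu>. u \<nu> = (w \<nu>, x \<nu>, \<eta> \<nu>, \<zeta> \<nu>)"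
  shows "(\<lambda>\<nu>. G_norm_sq \<rho> c (u \<nu> - u (Suc \<nu>))) \<in> o(\<lambda>\<nu>. 1 / real \<nu>) \<and>
         (\<lambda>\<nu>. (norm (x \<nu> - x (Suc \<nu>)))\<^sup>2) \<in> o(\<lambda>\<nu>. 1 / real \<nu>) \<and>
         (\<lambda>\<nu>. (norm (\<Sum>k\<in>UNIV. E *v block b k (x (Suc \<nu>))))\<^sup>2) \<in> o(\<lambda>\<nu>. 1 / real \<nu>)"
proof -
  note pd = assms(1) and pos = assms(3,4) and ada = assms(5) and u = assms(6)
  define a where "a \<nu> = G_norm_sq \<rho> c (u (Suc \<nu>) - u \<nu>)" for \<nu>
  have a0: "0 \<le> a \<nu>" for \<nu> unfolding a_def by (rule G_norm_sq_nonneg[OF pos])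
  obtain xb yb where xb: "xb \<in> block_product b X" "\<And>k. f k (block b k xb) \<noteq> \<infinity>" "E *v xb = 0"
    and saddle: "\<And>z. z \<in> block_product b X \<Longrightarrow> (\<And>k. f k (block b k z) \<noteq> \<infinity>) \<Longrightarrow>
           real_objective b f xb \<le> real_objective b f z + (E *v z) \<bullet> yb"
    using saddle_point_exists[OF assms(1,2)] by metis
  define us where "us = (block_image b E xb :: real ^ 'm ^ 'k, xb, (\<chi> k. yb) :: real ^ 'm ^ 'k,
    (\<chi> k. yb) :: real ^ 'm ^ 'k)"
  have fejer: "G_norm_sq \<rho> c (u (Suc \<nu>) - us) + a \<nu> \<le> G_norm_sq \<rho> c (u \<nu> - us)" for \<nu>
    unfolding a_def by (rule ada_fejer[OF pd ada pos xb saddle u us_def])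
  \<comment> \<open>Telescoping: the remaining distance to \<open>us\<close> stays in the claim so
    that the induction closes.\<close>
  have "sum a {..<n} + G_norm_sq \<rho> c (u n - us) \<le> G_norm_sq \<rho> c (u 0 - us)" for n
  proof (induction n)
    case (Suc n)
    thus ?case using fejer[of n] by simp
  qed simp
  hence "sum a {..<n} \<le> G_norm_sq \<rho> c (u 0 - us)" for n
    using G_norm_sq_nonneg[OF pos, of "u n - us"] by (smt (verit))
  hence "summable a" by (intro summableI_nonneg_bounded a0)
  moreover have "decseq a"
    unfolding a_def by (intro decseq_SucI ada_step_antimono[OF pd ada pos xb(1,2) u])
  ultimately have a: "a \<in> o(\<lambda>\<nu>. 1 / real \<nu>)"
    by (intro summable_decseq_smallo a0)
  \<comment> \<open>The four parts of the squared G-norm are nonnegative, so each is bounded by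
    \<open>a \<nu>\<close>; clearing the weights gives the factors \<open>c\<close> and
    \<open>\<rho>\<close>.\<close>
  have le: "norm (x (Suc \<nu>) - x \<nu>) ^ 2 \<le> c * a \<nu>" "norm (\<zeta> (Suc \<nu>) - \<zeta> \<nu>) ^ 2 \<le> \<rho> * a \<nu>" for \<nu>
  proof -
    let ?t = "\<rho> * (norm (w (Suc \<nu>) - w \<nu>))\<^sup>2" and ?e = "1 / \<rho> * (norm (\<eta> (Suc \<nu>) - \<eta> \<nu>))\<^sup>2"
      and ?x = "1 / c * (norm (x (Suc \<nu>) - x \<nu>))\<^sup>2" and ?z = "1 / \<rho> * (norm (\<zeta> (Suc \<nu>) - \<zeta> \<nu>))\<^sup>2"
    have "a \<nu> = ?t + ?x + ?e + ?z" by (simp add: a_def u)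
    moreover have "0 \<le> ?t" "0 \<le> ?x" "0 \<le> ?e" "0 \<le> ?z" using pos by simp_all
    ultimately have "?x \<le> a \<nu>" "?z \<le> a \<nu>" by linarith+
    thus "norm (x (Suc \<nu>) - x \<nu>) ^ 2 \<le> c * a \<nu>" "norm (\<zeta> (Suc \<nu>) - \<zeta> \<nu>) ^ 2 \<le> \<rho> * a \<nu>"
      using pos by (simp_all add: field_simps)
  qed
  \<comment> \<open>Both remaining rates follow by domination: each quantity is at most a constant
    times \<open>a\<close>.\<close>
  have dom: "g \<in> o(\<lambda>\<nu>. 1 / real \<nu>)" if "\<And>\<nu>. 0 \<le> g \<nu>" "\<And>\<nu>. g \<nu> \<le> C * a \<nu>" for g C
  proof (rule landau_o.big_small_trans[OF _ a], rule bigoI)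
    show "\<forall>\<^sub>F \<nu> in sequentially. norm (g \<nu>) \<le> C * norm (a \<nu>)"
      using that a0 by simp
  qed
  have "G_norm_sq \<rho> c (u \<nu> - u (Suc \<nu>)) = a \<nu>" for \<nu>
    by (simp add: a_def u norm_minus_commute)
  moreover have "(norm (x \<nu> - x (Suc \<nu>)))\<^sup>2 \<le> c * a \<nu>" for \<nu>
    using le(1)[of \<nu>] by (simp add: norm_minus_commute)
  moreover have "(norm (E *v x (Suc \<nu>)))\<^sup>2 \<le> ((2 * real CARD('k) / \<rho>)\<^sup>2 * \<rho>) * a \<nu>" for \<nu>
    using ada_constraint_bound[OF ada pos(1), of \<nu>] 
      mult_left_mono[OF le(2)[of \<nu>] zero_le_power2, of "2 * real CARD('k) / \<rho>"]
    by (simp only: mult.assoc)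
  moreover have "(\<Sum>k\<in>UNIV. E *v block b k z) = E *v z" for z
    using sum_block_image[of b E z] by (simp add: block_image_def)
  ultimately show ?thesis
    using a by (auto intro!: dom[of "\<lambda>\<nu>. (norm (x \<nu> - x (Suc \<nu>)))\<^sup>2" c]
        dom[of "\<lambda>\<nu>. (norm (E *v x (Suc \<nu>)))\<^sup>2" "(2 * real CARD('k) / \<rho>)\<^sup>2 * \<rho>"])
qed

end
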